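(* Let $0\leq\alpha<1$. For every $f\in\mathcal{R}(\alpha)$ one has $$|S'_f(0)|\leq 12(1-\alpha).$$ This bound is sharp, i.e., for each such $\alpha$ there is a function $f\in\mathcal{R}(\alpha)$ for which equality holds.
   Context: Let $\mathbb{D}=\{z\in\mathbb{C}:|z|<1\}$, and let $\mathcal{A}$ be the family of functions $f$ analytic in $\mathbb{D}$ with $f(0)=0$ and $f'(0)=1$. For $0\leq\alpha<1$, $$\mathcal{R}(\alpha)=\{f\in\mathcal{A}:\ \operatorname{Re} f'(z)>\alpha \text{ for all } z\in\mathbb{D}\}.$$ For a locally univalent function $f$ in $\mathbb{D}$, the Schwarzian derivative is $$S_f(z)=\left(\frac{f''(z)}{f'(z)}\right)'-\frac12\left(\frac{f''(z)}{f'(z)}\right)^2,$$ and $S'_f(0)$ denotes the value at $0$ of the derivative of the function $S_f$. *)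

theory Defs
  imports "HOL-Complex_Analysis.Complex_Analysis"
begin

(* Functions on the unit disc are total functions on the complex plane; only their values on
   ball 0 1 matter, since the disc is open and so deriv depends only on nearby values. *)

definition normalized_analytic :: "(complex \<Rightarrow> complex) set" where
  "normalized_analytic = {f. f analytic_on ball 0 1 \<and> f 0 = 0 \<and> deriv f 0 = 1}"

definition bounded_turning :: "real \<Rightarrow> (complex \<Rightarrow> complex) set" where
  "bounded_turning \<alpha> = {f \<in> normalized_analytic. \<forall>z \<in> ball 0 1. Re (deriv f z) > \<alpha>}"

(* Meaningful where f is locally univalent (deriv f z nonzero); this holds on the whole disc for
   members of bounded_turning \<alpha> with \<alpha> \<ge> 0. *)
definition schwarzian :: "(complex \<Rightarrow> complex) \<Rightarrow> complex \<Rightarrow> complex" where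
  "schwarzian f z =
     deriv (\<lambda>w. deriv (deriv f) w / deriv f w) z - 1 / 2 * (deriv (deriv f) z / deriv f z)\<^sup>2"

end

theory Submission
  imports Defs
begin

text \<open>With g = f', the derivative of the Schwarzian at 0 is g'''(0) - 4 g'(0) g''(0) + 3
  g'(0)^3 (\<open>deriv_schwarzian\<close>). In the Taylor coefficients b1, b2, b3 of P = g -
  \<alpha> this is 6 b3 - 8 b1 b2 + 3 b1^3. Since Re P > 0 and P(0) = 1 - \<alpha>, what remains is
  a coefficient problem for functions of positive real part
  (\<open>positive_Re_cubic_bound\<close>). On a circle of radius r < 1, Re P dt is a positive
  measure of mass Re P(0) with moments r^k b_k / 2. Integrating the pointwise bound |q (q - w)^2| =
  |q - w|^2 for |q| = 1 against it and letting r tend to 1 gives an inequality with a free complex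
  parameter w (\<open>positive_Re_coefficient_bound\<close>). A multiple of b1 as w produces the
  mixed term b1 b2, and the leftover cube is controlled by |b1| \<le> 2 Re P(0). Equality holds when
  f' is the function of z^3 for which b1 = b2 = 0 and b3 = 2 (1 - \<alpha>).\<close>

section \<open>Fourier coefficients on circles inside the disc\<close>

lemma circle_coefficient:
  fixes P :: "complex \<Rightarrow> complex" and r :: real
  assumes hol: "P holomorphic_on ball 0 1" and r: "0 < r" "r < 1"
  shows "((\<lambda>t. P (r * cis (2 * pi * t)) * cis (- (2 * pi * t)) ^ k) has_integral
           r ^ k * ((deriv ^^ k) P 0 / fact k)) {0..1}"
proof -
  have sub: "cball 0 r \<subseteq> ball (0::complex) 1" "ball 0 r \<subseteq> ball (0::complex) 1"
    using r by auto
  have "((\<lambda>u. P u / (u - 0) ^ Suc k) has_contour_integral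
          (2 * pi * \<i>) / fact k * (deriv ^^ k) P 0) (circlepath 0 r)"
    using r sub hol
    by (intro Cauchy_has_contour_integral_higher_derivative_circlepath)
       (auto intro: holomorphic_on_imp_continuous_on holomorphic_on_subset)
  then have "((\<lambda>x. P (circlepath 0 r x) / circlepath 0 r x ^ Suc k
      * vector_derivative (circlepath 0 r) (at x within {0..1})) has_integral
      (2 * pi * \<i>) / fact k * (deriv ^^ k) P 0) {0..1}"
    by (simp add: has_contour_integral_def)
  \<comment> \<open>This factor clears the constant of Cauchy's formula and the powers of r, leaving
    an integral in the angle alone.\<close>
  then have "((\<lambda>x. r ^ k / (2 * pi * \<i>) * (P (circlepath 0 r x) / circlepath 0 r x ^ Suc k
      * vector_derivative (circlepath 0 r) (at x within {0..1}))) has_integral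
      r ^ k / (2 * pi * \<i>) * ((2 * pi * \<i>) / fact k * (deriv ^^ k) P 0)) {0..1}"
    by (rule has_integral_mult_right)
  also have "r ^ k / (2 * pi * \<i>) * ((2 * pi * \<i>) / fact k * (deriv ^^ k) P 0) =
      r ^ k * ((deriv ^^ k) P 0 / fact k)"
  proof -
    have cancel: "a / c * (c / d * e) = a * (e / d)" if "c \<noteq> 0" for a c d e :: complex
      using that by simp
    show ?thesis by (rule cancel) simp
  qed
  finally show ?thesis
  proof (rule has_integral_eq[rotated])
    fix x :: real assume x: "x \<in> {0..1}"
    have e: "exp (2 * of_real pi * \<i> * of_real x) = cis (2 * pi * x)"
      by (simp add: cis_conv_exp mult_ac)
    have vd: "vector_derivative (circlepath 0 r) (at x within {0..1}) =
        2 * pi * \<i> * r * cis (2 * pi * x)"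
      using x by (simp add: vector_derivative_circlepath01 e)
    have c: "circlepath 0 r x = r * cis (2 * pi * x)"
      by (simp add: circlepath e)
    show "r ^ k / (2 * pi * \<i>) * (P (circlepath 0 r x) / circlepath 0 r x ^ Suc k
      * vector_derivative (circlepath 0 r) (at x within {0..1})) =
      P (r * cis (2 * pi * x)) * cis (- (2 * pi * x)) ^ k"
      using r by (simp add: vd c cis_inverse[symmetric] field_simps del: cis_inverse)
  qed
qed

text \<open>Cauchy's theorem for P(u) u^k: the Fourier coefficients of negative index vanish. The
  exponent is \<open>Suc k\<close> because du contributes one more factor u.\<close>

lemma circle_negative_coefficient:
  fixes P :: "complex \<Rightarrow> complex" and r :: real
  assumes hol: "P holomorphic_on ball 0 1" and r: "0 < r" "r < 1"
  shows "((\<lambda>t. P (r * cis (2 * pi * t)) * cis (2 * pi * t) ^ Suc k) has_integral 0) {0..1}"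
proof -
  have "((\<lambda>u. P u * u ^ k) has_contour_integral 0) (circlepath 0 r)"
    using r hol
    by (intro Cauchy_theorem_disc_simple[of _ 0 1] holomorphic_intros) auto
  then have "((\<lambda>x. P (circlepath 0 r x) * circlepath 0 r x ^ k
      * vector_derivative (circlepath 0 r) (at x within {0..1})) has_integral 0) {0..1}"
    by (simp add: has_contour_integral_def)
  then have "((\<lambda>x. 1 / (2 * pi * \<i> * r ^ Suc k) * (P (circlepath 0 r x) * circlepath 0 r x ^ k
      * vector_derivative (circlepath 0 r) (at x within {0..1}))) has_integral
      1 / (2 * pi * \<i> * r ^ Suc k) * 0) {0..1}"
    by (rule has_integral_mult_right)
  then have "((\<lambda>x. 1 / (2 * pi * \<i> * r ^ Suc k) * (P (circlepath 0 r x) * circlepath 0 r x ^ k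
      * vector_derivative (circlepath 0 r) (at x within {0..1}))) has_integral 0) {0..1}"
    by simp
  then show ?thesis
  proof (rule has_integral_eq[rotated])
    fix x :: real assume x: "x \<in> {0..1}"
    have e: "exp (2 * of_real pi * \<i> * of_real x) = cis (2 * pi * x)"
      by (simp add: cis_conv_exp mult_ac)
    have vd: "vector_derivative (circlepath 0 r) (at x within {0..1}) =
        2 * pi * \<i> * r * cis (2 * pi * x)"
      using x by (simp add: vector_derivative_circlepath01 e)
    have c: "circlepath 0 r x = r * cis (2 * pi * x)"
      by (simp add: circlepath e)
    show "1 / (2 * pi * \<i> * r ^ Suc k) * (P (circlepath 0 r x) * circlepath 0 r x ^ k
      * vector_derivative (circlepath 0 r) (at x within {0..1})) =
      P (r * cis (2 * pi * x)) * cis (2 * pi * x) ^ Suc k"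
      using r by (simp add: vd c field_simps)
  qed
qed

text \<open>Re P is half the sum of P and its conjugate, and the conjugate contributes the conjugate
  of a vanishing negative coefficient. At k = 0 both halves contribute, so the mean is treated
  separately in \<open>circle_mean_Re\<close>.\<close>

lemma circle_moment_Re:
  fixes P :: "complex \<Rightarrow> complex" and r :: real
  assumes hol: "P holomorphic_on ball 0 1" and r: "0 < r" "r < 1" and k: "0 < k"
  shows "((\<lambda>t. Re (P (r * cis (2 * pi * t))) * cis (- (2 * pi * t)) ^ k) has_integral
           r ^ k * ((deriv ^^ k) P 0 / fact k) / 2) {0..1}"
proof -
  obtain j where j: "k = Suc j" using k gr0_implies_Suc by blast
  have "((\<lambda>t. cnj (P (r * cis (2 * pi * t)) * cis (2 * pi * t) ^ k)) has_integral 0) {0..1}"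
    using has_integral_linear[OF circle_negative_coefficient[OF hol r, of j] bounded_linear_cnj]
    by (simp add: o_def j)
  from has_integral_add[OF circle_coefficient[OF hol r, of k] this]
  have "((\<lambda>t. 1 / 2 * (P (r * cis (2 * pi * t)) * cis (- (2 * pi * t)) ^ k +
      cnj (P (r * cis (2 * pi * t)) * cis (2 * pi * t) ^ k))) has_integral
      1 / 2 * (r ^ k * ((deriv ^^ k) P 0 / fact k) + 0)) {0..1}"
    by (rule has_integral_mult_right)
  then show ?thesis
    by (rule has_integral_eq_rhs[OF has_integral_eq[rotated]])
       (simp_all add: cis_cnj ring_distribs[symmetric] complex_add_cnj mult.commute)
qed

lemma circle_mean_Re:
  fixes P :: "complex \<Rightarrow> complex" and r :: real
  assumes hol: "P holomorphic_on ball 0 1" and r: "0 < r" "r < 1"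
  shows "((\<lambda>t. Re (P (r * cis (2 * pi * t)))) has_integral Re (P 0)) {0..1}"
  using has_integral_linear[OF circle_coefficient[OF hol r, of 0] bounded_linear_Re]
  by (simp add: o_def)

section \<open>Coefficient inequalities for functions with nonnegative real part\<close>

text \<open>The positive measure Re P dt on the circle of radius r bounds the integral of
  q (q - w)^2 by that of |q - w|^2, where q = cis (- 2 pi t); then r tends to 1.\<close>

lemma positive_Re_coefficient_bound:
  fixes P :: "complex \<Rightarrow> complex"
  assumes hol: "P holomorphic_on ball 0 1" and pos: "\<And>z. z \<in> ball 0 1 \<Longrightarrow> 0 \<le> Re (P z)"
  defines "b \<equiv> \<lambda>k. (deriv ^^ k) P 0 / fact k"
  shows "norm (b 3 - 2 * w * b 2 + w\<^sup>2 * b 1) \<le>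
           2 * (Re (P 0) * (1 + (norm w)\<^sup>2) - Re (cnj w * b 1))"
proof -
  have ineq: "norm (of_real r ^ 3 * b 3 / 2 - 2 * w * (of_real r ^ 2 * b 2 / 2) + w\<^sup>2 * (of_real r ^ 1 * b 1 / 2)) \<le>
      (1 + (norm w)\<^sup>2) * Re (P 0) - 2 * Re (cnj w * (of_real r ^ 1 * b 1 / 2))"
    if r: "0 < r" "r < 1" for r :: real
  proof -
    define \<rho> where "\<rho> = (\<lambda>t. Re (P (r * cis (2 * pi * t))))"
    define q where "q = (\<lambda>t. cis (- (2 * pi * t)))"
    have m: "((\<lambda>t. \<rho> t * q t ^ k) has_integral of_real r ^ k * b k / 2) {0..1}" if "0 < k" for k
      using circle_moment_Re[OF hol r that] by (simp add: \<rho>_def q_def b_def)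
    have m0: "(\<rho> has_integral Re (P 0)) {0..1}"
      using circle_mean_Re[OF hol r] by (simp add: \<rho>_def)
    \<comment> \<open>These are the densities \<rho> q (q - w)^2 and \<rho> |q - w|^2, expanded
      (using |q| = 1) into terms whose integrals are the moments.\<close>
    let ?F = "\<lambda>t. \<rho> t * q t ^ 3 - 2 * w * (\<rho> t * q t ^ 2) + w\<^sup>2 * (\<rho> t * q t ^ 1)"
    let ?G = "\<lambda>t. (1 + (norm w)\<^sup>2) * \<rho> t - 2 * Re (cnj w * (\<rho> t * q t ^ 1))"
    have F: "(?F has_integral (of_real r ^ 3 * b 3 / 2 - 2 * w * (of_real r ^ 2 * b 2 / 2) + w\<^sup>2 * (of_real r ^ 1 * b 1 / 2))) {0..1}"
      by (intro has_integral_add has_integral_diff has_integral_mult_right m) simp_all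
    have Re: "((\<lambda>t. Re (cnj w * (\<rho> t * q t ^ 1))) has_integral Re (cnj w * (of_real r ^ 1 * b 1 / 2))) {0..1}"
      using has_integral_linear[OF has_integral_mult_right[OF m[of 1], of "cnj w"] bounded_linear_Re]
      by (simp add: o_def)
    have G: "(?G has_integral ((1 + (norm w)\<^sup>2) * Re (P 0) - 2 * Re (cnj w * (of_real r ^ 1 * b 1 / 2)))) {0..1}"
      by (intro has_integral_diff has_integral_mult_right m0 Re)
    have FG: "norm (?F t) \<le> ?G t" for t
    proof -
      have \<rho>: "0 \<le> \<rho> t" unfolding \<rho>_def using r by (intro pos) (simp add: norm_mult)
      have nq: "norm (q t) = 1" by (simp add: q_def)
      have "?F t = \<rho> t * (q t * (q t - w)\<^sup>2)"
        by (simp add: power2_eq_square power3_eq_cube algebra_simps)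
      then have "norm (?F t) = \<rho> t * (norm (q t - w))\<^sup>2"
        using \<rho> nq by (simp add: norm_mult norm_power)
      also have "(norm (q t - w))\<^sup>2 = (norm (q t))\<^sup>2 + (norm w)\<^sup>2 - 2 * Re (cnj w * q t)"
        unfolding cmod_power2 by (simp add: power2_eq_square algebra_simps)
      also have "\<rho> t * \<dots> = ?G t"
        using nq by (simp add: algebra_simps)
      finally show ?thesis by simp
    qed
    have "norm (integral {0..1} ?F) \<le> integral {0..1} ?G"
      by (rule integral_norm_bound_integral) (use F G FG in \<open>auto simp: integrable_on_def\<close>)
    then show ?thesis using integral_unique[OF F] integral_unique[OF G] by simp
  qed
  \<comment> \<open>P need not extend to the unit circle, but after integration both sides are
    continuous in r, so the non-strict inequality passes to r = 1.\<close>
  have "norm (of_real 1 ^ 3 * b 3 / 2 - 2 * w * (of_real 1 ^ 2 * b 2 / 2) + w\<^sup>2 * (of_real 1 ^ 1 * b 1 / 2)) \<le>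
      (1 + (norm w)\<^sup>2) * Re (P 0) - 2 * Re (cnj w * (of_real 1 ^ 1 * b 1 / 2))"
  proof (rule tendsto_le)
    show "((\<lambda>r::real. norm (of_real r ^ 3 * b 3 / 2 - 2 * w * (of_real r ^ 2 * b 2 / 2) + w\<^sup>2 * (of_real r ^ 1 * b 1 / 2)))
      \<longlongrightarrow> norm (of_real 1 ^ 3 * b 3 / 2 - 2 * w * (of_real 1 ^ 2 * b 2 / 2) + w\<^sup>2 * (of_real 1 ^ 1 * b 1 / 2)))
      (at_left 1)" by (intro tendsto_intros) auto
    show "((\<lambda>r::real. (1 + (norm w)\<^sup>2) * Re (P 0) - 2 * Re (cnj w * (of_real r ^ 1 * b 1 / 2)))
      \<longlongrightarrow> (1 + (norm w)\<^sup>2) * Re (P 0) - 2 * Re (cnj w * (of_real 1 ^ 1 * b 1 / 2)))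
      (at_left 1)" by (intro tendsto_intros) auto
    show "\<forall>\<^sub>F r::real in at_left 1.
        norm (of_real r ^ 3 * b 3 / 2 - 2 * w * (of_real r ^ 2 * b 2 / 2) + w\<^sup>2 * (of_real r ^ 1 * b 1 / 2))
        \<le> (1 + (norm w)\<^sup>2) * Re (P 0) - 2 * Re (cnj w * (of_real r ^ 1 * b 1 / 2))"
      using eventually_at_left_real[OF zero_less_one[where 'a = real]] 
    proof eventually_elim
      case (elim x)
      show ?case by (rule ineq) (use elim in auto)
    qed
  qed simp
  then have "norm (b 3 / 2 - 2 * w * (b 2 / 2) + w\<^sup>2 * (b 1 / 2)) \<le>
      (1 + (norm w)\<^sup>2) * Re (P 0) - 2 * Re (cnj w * (b 1 / 2))"
    by (simp only: of_real_1 power_one mult_1_left)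
  also have "b 3 / 2 - 2 * w * (b 2 / 2) + w\<^sup>2 * (b 1 / 2) = (b 3 - 2 * w * b 2 + w\<^sup>2 * b 1) / 2"
    by (simp add: field_simps)
  also have "norm \<dots> = norm (b 3 - 2 * w * b 2 + w\<^sup>2 * b 1) / 2"
    by (simp only: norm_divide norm_numeral)
  also have "2 * Re (cnj w * (b 1 / 2)) = Re (cnj w * b 1)" by simp
  finally show ?thesis by argo
qed

text \<open>The choice w = (2/3) b1 turns the bound above into one for all but the multiple
  (1/3) b1^3 of the target; that remainder is absorbed by the slack in |b1|^2.\<close>

lemma positive_Re_cubic_bound:
  fixes P :: "complex \<Rightarrow> complex"
  assumes hol: "P holomorphic_on ball 0 1" and pos: "\<And>z. z \<in> ball 0 1 \<Longrightarrow> 0 \<le> Re (P z)"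
    and le1: "Re (P 0) \<le> 1"
  defines "b \<equiv> \<lambda>k. (deriv ^^ k) P 0 / fact k"
  shows "norm (6 * b 3 - 8 * b 1 * b 2 + 3 * b 1 ^ 3) \<le> 12 * Re (P 0)"
proof -
  have bound: "norm (b 3 - 2 * w * b 2 + w\<^sup>2 * b 1) \<le>
      2 * (Re (P 0) * (1 + (norm w)\<^sup>2) - Re (cnj w * b 1))" for w
    unfolding b_def by (rule positive_Re_coefficient_bound[OF hol pos])
  define \<beta> where "\<beta> = Re (P 0)"
  define x where "x = norm (b 1)"
  have x0: "0 \<le> x" by (simp add: x_def)
  have sq: "Re (cnj (b 1) * b 1) = x\<^sup>2"
    unfolding x_def cmod_power2 by (simp add: power2_eq_square)
  \<comment> \<open>Caratheodory's bound on the first coefficient: the right-hand side of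
    \<open>bound\<close> is nonnegative, and for the unimodular w in the direction of b1 it equals 2
    (2 \<beta> - x).\<close>
  have x2: "x \<le> 2 * \<beta>"
  proof (cases "b 1 = 0")
    case True
    then show ?thesis using pos[of 0] by (simp add: x_def \<beta>_def)
  next
    case False
    then have xp: "x > 0" by (simp add: x_def)
    define w where "w = b 1 / x"
    have "cnj w * b 1 = (cnj (b 1) * b 1) / x" by (simp add: w_def)
    then have "Re (cnj w * b 1) = x"
      using sq xp by (simp add: Re_divide_of_real power2_eq_square)
    moreover have "norm w = 1" using xp by (simp add: w_def norm_divide x_def)
    moreover have "0 \<le> 2 * (\<beta> * (1 + (norm w)\<^sup>2) - Re (cnj w * b 1))"
      unfolding \<beta>_def by (rule order_trans[OF norm_ge_zero bound])
    ultimately show ?thesis by simp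
  qed
  define w where "w = 2 / 3 * b 1"
  have Re_w: "Re (cnj w * b 1) = 2 / 3 * x\<^sup>2"
    using sq by (simp add: w_def)
  have norm_w: "(norm w)\<^sup>2 = 4 / 9 * x\<^sup>2"
    by (simp add: w_def norm_mult x_def power_mult_distrib power2_eq_square)
  have main: "norm (b 3 - 2 * w * b 2 + w\<^sup>2 * b 1) \<le> 2 * (\<beta> * (1 + 4 / 9 * x\<^sup>2) - 2 / 3 * x\<^sup>2)"
    using bound[of w] unfolding Re_w norm_w \<beta>_def .
  have "6 * b 3 - 8 * b 1 * b 2 + 3 * b 1 ^ 3 =
      6 * (b 3 - 2 * w * b 2 + w\<^sup>2 * b 1) + b 1 ^ 3 / 3"
    by (simp add: w_def power2_eq_square power3_eq_cube algebra_simps)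
  then have "norm (6 * b 3 - 8 * b 1 * b 2 + 3 * b 1 ^ 3) \<le>
      norm (6 * (b 3 - 2 * w * b 2 + w\<^sup>2 * b 1)) + norm (b 1 ^ 3 / 3)"
    by (metis norm_triangle_ineq)
  also have "\<dots> = 6 * norm (b 3 - 2 * w * b 2 + w\<^sup>2 * b 1) + x ^ 3 / 3"
    unfolding norm_mult[of 6] by (simp add: norm_divide norm_power x_def)
  also have "\<dots> \<le> 12 * (\<beta> * (1 + 4 / 9 * x\<^sup>2) - 2 / 3 * x\<^sup>2) + x ^ 3 / 3"
    using main by simp
  also have "\<dots> = 12 * \<beta> + x\<^sup>2 * (16 / 3 * \<beta> - 8 + x / 3)"
    by (simp add: power2_eq_square power3_eq_cube algebra_simps)
  also have "\<dots> \<le> 12 * \<beta>"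
  proof -
    \<comment> \<open>As x / 3 \<le> 2 \<beta> / 3, the left side is at most 6 \<beta> - 8, which is
      at most -2. Hence equality in the final bound forces b1 = 0.\<close>
    have "16 / 3 * \<beta> - 8 + x / 3 \<le> 0"
      using x2 le1 by (simp add: \<beta>_def)
    then have "x\<^sup>2 * (16 / 3 * \<beta> - 8 + x / 3) \<le> 0"
      by (intro mult_nonneg_nonpos) auto
    then show ?thesis by simp
  qed
  finally show ?thesis by (simp add: \<beta>_def)
qed

section \<open>The Schwarzian in terms of f', and the upper bound\<close>

text \<open>For g = f' the Schwarzian is g''/g - (3/2) (g'/g)^2. Differentiating gives g'''/g - 4 g'
  g''/g^2 + 3 (g'/g)^3, evaluated where g = 1.\<close>

lemma deriv_schwarzian:
  assumes hol: "deriv f holomorphic_on S" and S: "open S" "z \<in> S"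
    and nz: "\<And>z. z \<in> S \<Longrightarrow> deriv f z \<noteq> 0" and norm: "deriv f z = 1"
  shows "deriv (schwarzian f) z = (deriv ^^ 3) (deriv f) z
    - 4 * deriv (deriv f) z * (deriv ^^ 2) (deriv f) z + 3 * deriv (deriv f) z ^ 3"
proof -
  define g where "g = deriv f"
  have h: "g holomorphic_on S" "deriv g holomorphic_on S" "deriv (deriv g) holomorphic_on S"
    using hol S by (auto simp: g_def intro!: holomorphic_deriv)
  have d: "(g has_field_derivative deriv g w) (at w)"
     "(deriv g has_field_derivative deriv (deriv g) w) (at w)"
     "(deriv (deriv g) has_field_derivative deriv (deriv (deriv g)) w) (at w)" if "w \<in> S" for w
    using h S that by (auto intro: holomorphic_derivI)
  have nzg: "g w \<noteq> 0" if "w \<in> S" for w using nz[OF that] by (simp add: g_def)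
  have "schwarzian f w = deriv (deriv g) w / g w - 3 / 2 * (deriv g w / g w)\<^sup>2" if w: "w \<in> S" for w
  proof -
    have "((\<lambda>w. deriv g w / g w) has_field_derivative
        deriv (deriv g) w / g w - (deriv g w / g w)\<^sup>2) (at w)"
      using nzg[OF w] by (auto intro!: derivative_eq_intros d w simp: field_simps power2_eq_square)
    then show ?thesis
      unfolding schwarzian_def g_def[symmetric] by (simp add: DERIV_imp_deriv)
  qed
  then have "deriv (schwarzian f) z =
      deriv (\<lambda>w. deriv (deriv g) w / g w - 3 / 2 * (deriv g w / g w)\<^sup>2) z"
    using S by (intro deriv_cong_ev refl) (auto intro: eventually_mono[OF eventually_nhds_in_open])
  also have "\<dots> = deriv (deriv (deriv g)) z - 4 * deriv g z * deriv (deriv g) z + 3 * deriv g z ^ 3"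
    using norm
    by (intro DERIV_imp_deriv)
       (auto intro!: derivative_eq_intros d S nzg simp: g_def[symmetric] field_simps power2_eq_square power3_eq_cube)
  finally show ?thesis by (simp add: g_def numeral_eq_Suc)
qed

text \<open>The cubic bound applies to f' - \<alpha>, which differs from f' only in the constant
  coefficient. Since \<alpha> \<ge> 0, f' has no zeros in the disc, as the Schwarzian formula
  requires.\<close>

lemma bounded_turning_schwarzian_deriv_le:
  assumes "0 \<le> \<alpha>" and "\<alpha> < 1" and f: "f \<in> bounded_turning \<alpha>"
  shows "norm (deriv (schwarzian f) 0) \<le> 12 * (1 - \<alpha>)"
proof -
  define g where "g = deriv f"
  have "f holomorphic_on ball 0 1" and g0: "g 0 = 1" and pos: "\<And>z. z \<in> ball 0 1 \<Longrightarrow> Re (g z) > \<alpha>"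
    using f by (auto simp: bounded_turning_def normalized_analytic_def g_def analytic_imp_holomorphic)
  then have hol: "g holomorphic_on ball 0 1" by (auto simp: g_def intro: holomorphic_deriv)
  have nz: "g z \<noteq> 0" if "z \<in> ball 0 1" for z using pos[OF that] \<open>0 \<le> \<alpha>\<close> by auto
  have hP: "(\<lambda>z. g z - \<alpha>) holomorphic_on ball 0 1" by (intro holomorphic_intros hol)
  have dP: "(deriv ^^ k) (\<lambda>z. g z - \<alpha>) 0 = (deriv ^^ k) g 0" if "0 < k" for k
    using higher_deriv_diff[OF hol holomorphic_on_const, of 0 k "of_real \<alpha>"] that by simp
  have "norm (6 * ((deriv ^^ 3) g 0 / fact 3) - 8 * ((deriv ^^ 1) g 0 / fact 1) * ((deriv ^^ 2) g 0 / fact 2)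
      + 3 * ((deriv ^^ 1) g 0 / fact 1) ^ 3) \<le> 12 * (1 - \<alpha>)"
  proof -
    have "Re (g z - \<alpha>) \<ge> 0" if "z \<in> ball 0 1" for z using pos[OF that] by simp
    moreover have "Re (g 0 - \<alpha>) = 1 - \<alpha>" using g0 by simp
    ultimately show ?thesis
      using positive_Re_cubic_bound[OF hP] \<open>0 \<le> \<alpha>\<close>
      by (simp only: dP zero_less_numeral zero_less_one)
  qed
  moreover have "deriv (schwarzian f) 0 =
      (deriv ^^ 3) g 0 - 4 * deriv g 0 * (deriv ^^ 2) g 0 + 3 * deriv g 0 ^ 3"
    unfolding g_def
    by (rule deriv_schwarzian[where S = "ball 0 1"]) (use hol nz g0 in \<open>auto simp: g_def\<close>)
  ultimately show ?thesis by (simp add: fact_numeral mult.assoc)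
qed

section \<open>The extremal function\<close>

text \<open>In the cubic expression only the term in b3 survives for a function of z^3, and the Cayley
  transform of z^3 maximizes it.\<close>

lemma bounded_turning_schwarzian_deriv_sharp:
  assumes "0 \<le> \<alpha>" and "\<alpha> < 1"
  shows "\<exists>f \<in> bounded_turning \<alpha>. norm (deriv (schwarzian f) 0) = 12 * (1 - \<alpha>)"
proof -
  define g where "g = (\<lambda>z::complex. \<alpha> + (1 - \<alpha>) * ((1 + z ^ 3) / (1 - z ^ 3)))"
  \<comment> \<open>\<open>h\<close> is g'(z) / z^2 with the singularity at 0 removed. Keeping the
    factor z^2 apart lets the derivatives at 0 be read off without computing those of
    \<open>h\<close>.\<close>
  define h where "h = (\<lambda>z::complex. 6 * (1 - \<alpha>) / (1 - z ^ 3)\<^sup>2)"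
  let ?D = "ball (0::complex) 1"
  have lt: "norm (z ^ 3) < 1" if "z \<in> ?D" for z
    using that by (simp add: norm_power power_less_one_iff)
  then have ne: "1 - z ^ 3 \<noteq> 0" if "z \<in> ?D" for z using that by fastforce
  have hol: "g holomorphic_on ?D" "h holomorphic_on ?D"
    unfolding g_def h_def using ne by (auto intro!: holomorphic_intros)
  have pos: "Re (g z) > \<alpha>" if z: "z \<in> ?D" for z
  proof -
    define u where "u = z ^ 3"
    have u: "norm u < 1" and "1 - u \<noteq> 0" using lt[OF z] ne[OF z] by (auto simp: u_def)
    \<comment> \<open>The real part of this quotient is the Poisson kernel (1 - |u|^2) / |1 - u|^2,
      positive for |u| < 1.\<close>
    have "(1 + u) / (1 - u) = (1 + u) * cnj (1 - u) / of_real ((norm (1 - u))\<^sup>2)"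
      by (rule complex_div_cnj[of "1 + u" "1 - u", folded of_real_power])
    then have "Re ((1 + u) / (1 - u)) = (1 - (norm u)\<^sup>2) / (norm (1 - u))\<^sup>2"
      by (simp only: Re_divide_of_real cmod_power2[of u]) (simp add: power2_eq_square algebra_simps)
    also have "\<dots> > 0"
      using u \<open>1 - u \<noteq> 0\<close> by (intro divide_pos_pos) (auto simp: power_less_one_iff)
    finally have "0 < (1 - \<alpha>) * Re ((1 + u) / (1 - u))" using assms by simp
    moreover have "Re (g z) = \<alpha> + (1 - \<alpha>) * Re ((1 + u) / (1 - u))"
    proof -
      have "Re (complex_of_real \<alpha> + complex_of_real (1 - \<alpha>) * v) = \<alpha> + (1 - \<alpha>) * Re v" for v
        by simp
      then show ?thesis by (simp add: g_def u_def del: times_divide_eq_right)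
    qed
    ultimately show ?thesis by linarith
  qed
  \<comment> \<open>The disc is convex, so \<open>g\<close> has a primitive there; subtracting its
    value at 0 normalizes it.\<close>
  obtain F where F: "\<And>x. x \<in> ?D \<Longrightarrow> (F has_field_derivative g x) (at x within ?D)"
    using holomorphic_convex_primitive'[OF convex_ball open_ball hol(1)] by blast
  define f where "f = (\<lambda>z. F z - F 0)"
  have df: "(f has_field_derivative g z) (at z)" if "z \<in> ?D" for z
    using F[OF that] that by (auto simp: f_def at_within_open[of _ ?D] intro!: derivative_eq_intros)
  have g_eq: "deriv f z = g z" if "z \<in> ?D" for z using df[OF that] by (rule DERIV_imp_deriv)
  have "f holomorphic_on ?D" unfolding holomorphic_on_open[OF open_ball] using df by blast
  then have fmem: "f \<in> bounded_turning \<alpha>"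
    using pos g_eq by (simp add: bounded_turning_def normalized_analytic_def analytic_on_open f_def g_def)
  have holf: "deriv f holomorphic_on ?D"
    using hol(1) by (rule holomorphic_transform) (simp add: g_eq)
  \<comment> \<open>\<open>f\<close> and its derivatives are known only on the disc; openness is
    what allows such identities to be differentiated.\<close>
  have transfer: "deriv p z = deriv q z" if "z \<in> ?D" "\<And>z. z \<in> ?D \<Longrightarrow> p z = q z" for p q and z :: complex
    using that by (intro deriv_cong_ev refl) (auto intro: eventually_mono[OF eventually_nhds_in_open[of ?D]])
  have dh: "(h has_field_derivative deriv h z) (at z)"
    "(deriv h has_field_derivative deriv (deriv h) z) (at z)" if "z \<in> ?D" for z
    using that hol(2) by (auto intro!: holomorphic_derivI holomorphic_deriv)
  have d1: "deriv (deriv f) z = z\<^sup>2 * h z" if z: "z \<in> ?D" for z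
  proof -
    have "deriv (deriv f) z = deriv g z" by (rule transfer[OF z]) (rule g_eq)
    also have "\<dots> = z\<^sup>2 * h z"
      using ne[OF z] unfolding g_def h_def
      by (intro DERIV_imp_deriv)
         (auto intro!: derivative_eq_intros simp: field_simps power2_eq_square power3_eq_cube)
    finally show ?thesis .
  qed
  have d2: "deriv (deriv (deriv f)) z = 2 * z * h z + z\<^sup>2 * deriv h z" if z: "z \<in> ?D" for z
  proof -
    have "deriv (deriv (deriv f)) z = deriv (\<lambda>z. z\<^sup>2 * h z) z" by (rule transfer[OF z]) (rule d1)
    also have "\<dots> = 2 * z * h z + z\<^sup>2 * deriv h z"
      by (intro DERIV_imp_deriv) (auto intro!: derivative_eq_intros dh z)
    finally show ?thesis .
  qed
  have "deriv (deriv (deriv (deriv f))) 0 = deriv (\<lambda>z. 2 * z * h z + z\<^sup>2 * deriv h z) 0"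
    by (rule transfer) (auto intro: d2)
  also have "\<dots> = 2 * h 0"
    by (intro DERIV_imp_deriv) (auto intro!: derivative_eq_intros dh)
  finally have d3: "deriv (deriv (deriv (deriv f))) 0 = 12 * (1 - \<alpha>)" by (simp add: h_def)
  have "deriv f z \<noteq> 0" if "z \<in> ?D" for z
    using pos[OF that] assms by (auto simp: g_eq[OF that])
  then have "deriv (schwarzian f) 0 = (deriv ^^ 3) (deriv f) 0
      - 4 * deriv (deriv f) 0 * (deriv ^^ 2) (deriv f) 0 + 3 * deriv (deriv f) 0 ^ 3"
    by (intro deriv_schwarzian[OF holf]) (auto simp: g_eq g_def)
  \<comment> \<open>By \<open>d1\<close>, f''(0) = 0, so only the term with the fourth derivative of
    f survives.\<close>
  also have "\<dots> = of_real (12 * (1 - \<alpha>))"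
    using d3 by (simp add: numeral_eq_Suc d1)
  finally have "norm (deriv (schwarzian f) 0) = 12 * (1 - \<alpha>)"
    using assms by (simp only: norm_of_real) simp
  with fmem show ?thesis by blast
qed

theorem theorem1:
  fixes \<alpha> :: real
  assumes "0 \<le> \<alpha>" and "\<alpha> < 1"
  shows "(\<forall>f \<in> bounded_turning \<alpha>. norm (deriv (schwarzian f) 0) \<le> 12 * (1 - \<alpha>)) \<and>
         (\<exists>f \<in> bounded_turning \<alpha>. norm (deriv (schwarzian f) 0) = 12 * (1 - \<alpha>))"
  using bounded_turning_schwarzian_deriv_le[OF assms] bounded_turning_schwarzian_deriv_sharp[OF assms]
  by blast

end
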